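(* Let $M$ be a nonnegative real $k\times l$ matrix with no zero row and no zero column, and suppose there are permutation matrices $P$ ($k\times k$) and $Q$ ($l\times l$) such that $M=P\begin{pmatrix}M_1&&&\\&M_2&&\\&&\ddots&\\&&&M_p\end{pmatrix}Q,$ where each block $M_r$ (possibly rectangular) has all entries positive. Then there are a $k\times k$ diagonal matrix $D$ and an $l\times l$ diagonal matrix $E$, both with positive diagonal entries, such that for $N:=DME$ both $NN^{\mathsf T}$ and $N^{\mathsf T}N$ are doubly stochastic.
   Context: A real matrix is doubly stochastic if it is square, nonnegative, and all its row and column sums equal $1$. *)

theory Defs
  imports
    "HOL-Combinatorics.Permutations"
    "Jordan_Normal_Form.Matrix"
begin

definition nonneg_mat :: "real mat \<Rightarrow> bool" where
  "nonneg_mat A \<longleftrightarrow> (\<forall>i<dim_row A. \<forall>j<dim_col A. 0 \<le> A $$ (i,j))"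

definition positive_mat :: "real mat \<Rightarrow> bool" where
  "positive_mat A \<longleftrightarrow> (\<forall>i<dim_row A. \<forall>j<dim_col A. 0 < A $$ (i,j))"

definition permutation_mat :: "nat \<Rightarrow> real mat \<Rightarrow> bool" where
  "permutation_mat n P \<longleftrightarrow>
     (\<exists>\<pi>. \<pi> permutes {..<n} \<and> P = mat n n (\<lambda>(i,j). if j = \<pi> i then 1 else 0))"

definition positive_diagonal_mat :: "nat \<Rightarrow> real mat \<Rightarrow> bool" where
  "positive_diagonal_mat n D \<longleftrightarrow>
     D \<in> carrier_mat n n \<and> diagonal_mat D \<and> (\<forall>i<n. 0 < D $$ (i,i))"

definition doubly_stochastic :: "real mat \<Rightarrow> bool" where
  "doubly_stochastic A \<longleftrightarrow>
     square_mat A \<and> nonneg_mat A \<and>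
     (\<forall>i<dim_row A. (\<Sum>j<dim_col A. A $$ (i,j)) = 1) \<and>
     (\<forall>j<dim_col A. (\<Sum>i<dim_row A. A $$ (i,j)) = 1)"

end

theory Submission
  imports "HOL-Analysis.Function_Topology" Defs
begin

text \<open>Suppose that each block of \<open>N = DME\<close> has constant row sums \<open>r\<close> and constant column sums \<open>1/r\<close>.
  Since \<open>N\<^sup>T 1\<close> lists the column sums, \<open>N N\<^sup>T 1 = 1\<close>, and symmetrically \<open>N\<^sup>T N 1 = 1\<close>. Counting the
  total of an \<open>m \<times> n\<close> block in two ways forces \<open>r = sqrt (n/m)\<close>. A positive block can be scaled to
  any compatible marginals \<open>a\<close>, \<open>b\<close>: the shift-invariant function
  \<open>F x = (\<Sum>j. b j * ln (\<Sum>i. W i j * exp (x i))) - (\<Sum>i. a i * x i)\<close> is coercive on \<open>max x = 0\<close>,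
  hence has a global minimum, and its stationarity conditions are the row sum equations.\<close>

section \<open>Scaling positive blocks to prescribed marginals\<close>

lemma positive_scaling_exists:
  fixes W :: "'i \<Rightarrow> 'j \<Rightarrow> real"
  assumes I: "finite I" "I \<noteq> {}" and J: "finite J" "J \<noteq> {}"
    and W: "\<And>i j. i \<in> I \<Longrightarrow> j \<in> J \<Longrightarrow> 0 < W i j"
    and a: "\<And>i. i \<in> I \<Longrightarrow> 0 < a i" and b: "\<And>j. j \<in> J \<Longrightarrow> 0 < b j"
    and ab: "sum a I = sum b J"
  shows "\<exists>d e. (\<forall>i\<in>I. 0 < d i \<and> (\<Sum>j\<in>J. d i * W i j * e j) = a i) \<and>
               (\<forall>j\<in>J. 0 < e j \<and> (\<Sum>i\<in>I. d i * W i j * e j) = b j)"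
proof -
  define S where "S x j = (\<Sum>i\<in>I. W i j * exp (x i))" for x :: "'i \<Rightarrow> real" and j
  define F where "F x = (\<Sum>j\<in>J. b j * ln (S x j)) - (\<Sum>i\<in>I. a i * x i)" for x
  have S_pos: "0 < S x j" if "j \<in> J" for x j
    unfolding S_def using I W that by (intro sum_pos) auto
  \<comment> \<open>A shift by \<open>s\<close> lowers the logarithmic part by
    \<open>s * sum b J\<close> and the linear part by \<open>s * sum a I\<close>; these cancel by
    \<open>ab\<close>.\<close>
  have F_shift: "F y = F x" if y: "\<And>i. i \<in> I \<Longrightarrow> y i = x i - s" for x y s
  proof -
    have "S y j = S x j * exp (- s)" for j
      unfolding S_def sum_distrib_right using y by (intro sum.cong) (auto simp: exp_diff exp_minus divide_simps)
    hence "(\<Sum>j\<in>J. b j * ln (S y j)) = (\<Sum>j\<in>J. b j * ln (S x j) - b j * s)"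
      using S_pos[THEN less_imp_neq, THEN not_sym] S_pos
      by (intro sum.cong) (simp_all add: ln_mult algebra_simps)
    moreover have "(\<Sum>i\<in>I. a i * y i) = (\<Sum>i\<in>I. a i * x i - a i * s)"
      using y by (intro sum.cong) (simp_all add: right_diff_distrib)
    ultimately show ?thesis
      using ab by (simp add: F_def sum_subtractf flip: sum_distrib_right)
  qed
  define w where "w = Min ((\<lambda>(i,j). W i j) ` (I \<times> J))"
  have w_le: "w \<le> W i j" if "i \<in> I" "j \<in> J" for i j
    unfolding w_def using that I J by (intro Min_le) auto
  have "w \<in> (\<lambda>(i,j). W i j) ` (I \<times> J)"
    unfolding w_def using I J by (intro Min_in) auto
  hence w_pos: "0 < w" using W by auto
  define c where "c = sum b J * ln w"
  \<comment> \<open>This is the coercivity estimate. The coordinate \<open>m\<close> alone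
    contributes at least \<open>w\<close> to every \<open>S x j\<close>, and every term
    \<open>- a i' * x i'\<close> is nonnegative, so all but the one for \<open>i\<close> may be
    dropped.\<close>
  have F_lower: "c - a i * x i \<le> F x"
    if x: "\<And>i. i \<in> I \<Longrightarrow> x i \<le> 0" and m: "m \<in> I" "x m = 0" and i: "i \<in> I" for x m i
  proof -
    have "w \<le> S x j" if "j \<in> J" for j
    proof -
      have "W m j * exp (x m) \<le> S x j"
        unfolding S_def using I m W[OF _ that] by (intro member_le_sum) (auto intro: less_imp_le)
      thus ?thesis using w_le[OF m(1) that] m by simp
    qed
    hence "(\<Sum>j\<in>J. b j * ln w) \<le> (\<Sum>j\<in>J. b j * ln (S x j))"
      using w_pos b S_pos by (intro sum_mono mult_left_mono) (simp_all add: less_imp_le)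
    moreover have "(\<Sum>i'\<in>I - {i}. a i' * x i') \<le> 0"
      using x a by (intro sum_nonpos mult_nonneg_nonpos) (auto intro: less_imp_le)
    hence "(\<Sum>i'\<in>I. a i' * x i') \<le> a i * x i"
      using I i by (subst sum.remove[of _ i]) auto
    ultimately show ?thesis by (simp add: F_def c_def sum_distrib_right)
  qed
  \<comment> \<open>\<open>R\<close> is chosen so that \<open>x i < -R\<close> makes the bound in
    \<open>F_lower\<close> exceed the value of \<open>F\<close> at 0. Taking a sum of nonnegative
    terms dominates every \<open>i\<close> at once.\<close>
  define R where "R = (\<Sum>i\<in>I. \<bar>F (\<lambda>_. 0) - c\<bar> / a i)"
  have R: "\<bar>F (\<lambda>_. 0) - c\<bar> \<le> a i * R" if "i \<in> I" for i
  proof -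
    have "\<bar>F (\<lambda>_. 0) - c\<bar> / a i \<le> R"
      unfolding R_def using that I a by (intro member_le_sum) (auto simp: less_imp_le)
    thus ?thesis using a[OF that] by (simp add: field_simps)
  qed
  have R0: "0 \<le> R"
    unfolding R_def using a by (intro sum_nonneg) (simp add: less_imp_le)
  \<comment> \<open>The box constrains every coordinate of the type, also those outside
    \<open>I\<close>, on which \<open>F\<close> does not depend. It is then compact by Tychonoff's
    theorem, whether or not the type is finite.\<close>
  define K where "K = (UNIV::'i set) \<rightarrow>\<^sub>E {-R..0}"
  have "compact K"
    using compactin_PiE[of "\<lambda>_. euclidean" UNIV "\<lambda>_::'i. {-R..0::real}"]
    by (simp add: K_def euclidean_product_topology)
  moreover have "(\<lambda>_. 0) \<in> K" using R0 by (auto simp: K_def)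
  moreover have "continuous_on K F"
    unfolding F_def S_def using S_pos unfolding S_def
    by (intro continuous_intros continuous_on_product_then_coordinatewise) (auto simp: less_imp_neq[symmetric])
  ultimately obtain z where "z \<in> K" and z: "\<And>y. y \<in> K \<Longrightarrow> F z \<le> F y"
    using continuous_attains_inf[of K F] by blast
  \<comment> \<open>Subtracting the maximum over \<open>I\<close> normalises \<open>x\<close> to
    maximum 0 without changing \<open>F\<close>. The result \<open>y\<close>, set to 0 off
    \<open>I\<close>, lies in \<open>K\<close> or has a coordinate below \<open>-R\<close>, and then
    \<open>F y\<close> exceeds the value at 0.\<close>
  have z_min: "F z \<le> F x" for x
  proof -
    define s where "s = Max (x ` I)"
    define y where "y = (\<lambda>i. if i \<in> I then x i - s else 0)"
    have "s \<in> x ` I" unfolding s_def using I by (intro Max_in) auto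
    then obtain m where m: "m \<in> I" "x m = s" by auto
    have y0: "y i \<le> 0" if "i \<in> I" for i
      unfolding y_def s_def using I that by auto
    have "F z \<le> F y"
    proof (cases "\<forall>i\<in>I. - R \<le> y i")
      case True
      hence "y \<in> K" using y0 R0 by (auto simp: K_def y_def)
      thus ?thesis by (rule z)
    next
      case False
      then obtain i where i: "i \<in> I" "y i < - R" by force
      have "a i * y i < a i * (- R)" using a i by (intro mult_strict_left_mono) auto
      hence "F (\<lambda>_. 0) < c - a i * y i" using R[OF i(1)] by (simp add: abs_le_iff)
      also have "\<dots> \<le> F y" using m i y0 by (intro F_lower[of y m]) (auto simp: y_def)
      finally show ?thesis using z[OF \<open>(\<lambda>_. 0) \<in> K\<close>] by simp
    qed
    also have "F y = F x" by (rule F_shift) (simp add: y_def)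
    finally show ?thesis .
  qed
  \<comment> \<open>The derivative of \<open>F\<close> at \<open>z\<close> along coordinate
    \<open>i\<close> vanishes. With row factors \<open>exp (z i)\<close> and column factors
    \<open>b j / S z j\<close> this is exactly the equation for row \<open>i\<close>.\<close>
  have stationary: "(\<Sum>j\<in>J. exp (z i) * W i j * (b j / S z j)) = a i" if i: "i \<in> I" for i
  proof -
    define \<delta> :: "'i \<Rightarrow> real" where "\<delta> = (\<lambda>i'. if i' = i then 1 else 0)"
    have "((\<lambda>t. F (\<lambda>i'. z i' + t * \<delta> i')) has_real_derivative
             (\<Sum>j\<in>J. b j * ((\<Sum>i'\<in>I. W i' j * (exp (z i' + 0 * \<delta> i') * \<delta> i')) / S z j))
               - (\<Sum>i'\<in>I. a i' * \<delta> i')) (at 0)"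
      unfolding F_def S_def using S_pos[of _ z] unfolding S_def
      by (auto intro!: derivative_eq_intros sum.cong simp: mult_ac)
    hence "(\<Sum>j\<in>J. b j * ((\<Sum>i'\<in>I. W i' j * (exp (z i' + 0 * \<delta> i') * \<delta> i')) / S z j))
             - (\<Sum>i'\<in>I. a i' * \<delta> i') = 0"
      by (rule DERIV_local_min[of _ _ _ 1]) (auto intro: z_min)
    thus ?thesis using i I by (simp add: \<delta>_def if_distrib mult_ac cong: if_cong)
  qed
  \<comment> \<open>The column equations hold for any \<open>z\<close>: dividing by
    \<open>S z j\<close> normalises column \<open>j\<close>.\<close>
  have "(\<Sum>i\<in>I. exp (z i) * W i j * (b j / S z j)) = b j" if "j \<in> J" for j
  proof -
    have "(\<Sum>i\<in>I. exp (z i) * W i j * (b j / S z j)) = S z j * (b j / S z j)"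
      unfolding S_def[of z j] sum_distrib_right by (simp add: mult_ac)
    thus ?thesis using S_pos[OF that, of z] by simp
  qed
  thus ?thesis using stationary S_pos b
    by - (rule exI[where x = "\<lambda>i. exp (z i)"], rule exI[where x = "\<lambda>j. b j / S z j"], auto)
qed

text \<open>The labels \<open>f\<close> and \<open>g\<close> name the block of a row and of a
  column, so the blocks need not be contiguous. Each index carries a single label, and entries
  between different labels vanish; hence the blocks are scaled independently and their factors
  glued.\<close>

lemma block_scaling_exists:
  fixes M :: "nat \<Rightarrow> nat \<Rightarrow> real" and f g :: "nat \<Rightarrow> nat"
  assumes pos: "\<And>i j. i < k \<Longrightarrow> j < l \<Longrightarrow> f i = g j \<Longrightarrow> 0 < M i j"
    and zero: "\<And>i j. i < k \<Longrightarrow> j < l \<Longrightarrow> f i \<noteq> g j \<Longrightarrow> M i j = 0"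
    and row: "\<And>i. i < k \<Longrightarrow> \<exists>j<l. f i = g j"
    and col: "\<And>j. j < l \<Longrightarrow> \<exists>i<k. f i = g j"
  shows "\<exists>d e r. (\<forall>i<k. 0 < d i \<and> (\<Sum>j<l. d i * M i j * e j) = r (f i)) \<and>
                 (\<forall>j<l. 0 < e j \<and> (\<Sum>i<k. d i * M i j * e j) = 1 / r (g j)) \<and>
                 (\<forall>i<k. 0 < r (f i))"
proof -
  define I where "I s = {i. i < k \<and> f i = s}" for s
  define J where "J s = {j. j < l \<and> g j = s}" for s
  define r where "r s = sqrt (card (J s) / card (I s))" for s
  have fin: "finite (I s)" "finite (J s)" for s by (auto simp: I_def J_def)
  have ne: "I s \<noteq> {} \<longleftrightarrow> J s \<noteq> {}" for s
    using row col by (fastforce simp: I_def J_def)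
  \<comment> \<open>The second equation is the compatibility of the marginals: the row sums
    \<open>r s\<close> and the column sums \<open>1 / r s\<close> give the block the same
    total.\<close>
  have r: "0 < r s" "real (card (I s)) * r s = real (card (J s)) * (1 / r s)" if "I s \<noteq> {}" for s
  proof -
    have c: "0 < card (I s)" "0 < card (J s)" using that ne fin by (auto simp: card_gt_0_iff)
    thus "0 < r s" by (simp add: r_def)
    have "r s * r s = card (J s) / card (I s)" by (simp add: r_def)
    thus "real (card (I s)) * r s = real (card (J s)) * (1 / r s)"
      using c \<open>0 < r s\<close> by (simp add: field_simps)
  qed
  define scales where "scales s d e \<longleftrightarrow>
      (\<forall>i\<in>I s. 0 < d i \<and> (\<Sum>j\<in>J s. d i * M i j * e j) = r s) \<and>
      (\<forall>j\<in>J s. 0 < e j \<and> (\<Sum>i\<in>I s. d i * M i j * e j) = 1 / r s)"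
    for s and d e :: "nat \<Rightarrow> real"
  have "\<exists>d e. scales s d e" for s
  proof (cases "I s = {}")
    \<comment> \<open>A label carried by no row is carried by no column either, so there is nothing
      to scale.\<close>
    case True
    thus ?thesis using ne by (auto simp: scales_def)
  next
    case False
    show ?thesis
      unfolding scales_def using False ne[of s] fin r[OF False]
      by (intro positive_scaling_exists) (auto simp: I_def J_def intro: pos)
  qed
  then obtain d e where de: "\<And>s. scales s (d s) (e s)"
    by metis
  have
    d: "\<And>i. i \<in> I s \<Longrightarrow> 0 < d s i \<and> (\<Sum>j\<in>J s. d s i * M i j * e s j) = r s" and
    e: "\<And>j. j \<in> J s \<Longrightarrow> 0 < e s j \<and> (\<Sum>i\<in>I s. d s i * M i j * e s j) = 1 / r s" for s
    using de[of s] by (auto simp: scales_def)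
  have "(\<Sum>j<l. d (f i) i * M i j * e (g j) j) = r (f i)" if "i < k" for i
  proof -
    have "(\<Sum>j<l. d (f i) i * M i j * e (g j) j) = (\<Sum>j\<in>J (f i). d (f i) i * M i j * e (f i) j)"
      using zero[OF that] by (intro sum.mono_neutral_cong_right) (force simp: J_def)+
    thus ?thesis using d[of i "f i"] that by (simp add: I_def)
  qed
  moreover have "(\<Sum>i<k. d (f i) i * M i j * e (g j) j) = 1 / r (g j)" if "j < l" for j
  proof -
    have "(\<Sum>i<k. d (f i) i * M i j * e (g j) j) = (\<Sum>i\<in>I (g j). d (g j) i * M i j * e (g j) j)"
      using zero[OF _ that] by (intro sum.mono_neutral_cong_right) (force simp: I_def)+
    thus ?thesis using e[of j "g j"] that by (simp add: J_def)
  qed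
  moreover have "0 < d (f i) i" "0 < r (f i)" if "i < k" for i
    using that d[of i "f i"] r(1)[of "f i"] by (auto simp: I_def)
  moreover have "0 < e (g j) j" if "j < l" for j
    using that e[of j "g j"] by (auto simp: J_def)
  ultimately show ?thesis
    by - (rule exI[of _ "\<lambda>i. d (f i) i"], rule exI[of _ "\<lambda>j. e (g j) j"],
      rule exI[of _ r], auto)
qed

section \<open>Zero patterns of block diagonal and permuted matrices\<close>

lemma diag_block_mat_pattern:
  fixes Ms :: "real mat list"
  assumes "\<forall>B\<in>set Ms. positive_mat B"
  shows "\<exists>f g :: nat \<Rightarrow> nat. \<forall>i<dim_row (diag_block_mat Ms). \<forall>j<dim_col (diag_block_mat Ms).
           if f i = g j then 0 < diag_block_mat Ms $$ (i,j) else diag_block_mat Ms $$ (i,j) = 0"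
  using assms
proof (induction Ms)
  case Nil
  show ?case by simp
next
  case (Cons A Ms)
  then obtain f g :: "nat \<Rightarrow> nat" where
    fg: "\<forall>i<dim_row (diag_block_mat Ms). \<forall>j<dim_col (diag_block_mat Ms).
           if f i = g j then 0 < diag_block_mat Ms $$ (i,j) else diag_block_mat Ms $$ (i,j) = 0"
    by auto
  \<comment> \<open>The first block gets label 0, and \<open>Suc\<close> keeps the labels of the
    remaining blocks apart from it.\<close>
  let ?f = "\<lambda>i. if i < dim_row A then 0 else Suc (f (i - dim_row A))"
  let ?g = "\<lambda>j. if j < dim_col A then 0 else Suc (g (j - dim_col A))"
  have "positive_mat A" using Cons.prems by simp
  thus ?case
    using fg by - (rule exI[of _ ?f], rule exI[of _ ?g], auto simp: Let_def positive_mat_def)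
qed

lemma permutation_mat_mult_index:
  assumes "permutation_mat k P" "permutation_mat l Q" "B \<in> carrier_mat k l"
  obtains \<pi> \<sigma> where "\<And>i. i < k \<Longrightarrow> \<pi> i < k" "\<And>j. j < l \<Longrightarrow> \<sigma> j < l"
    "\<And>i j. i < k \<Longrightarrow> j < l \<Longrightarrow> (P * B * Q) $$ (i,j) = B $$ (\<pi> i, \<sigma> j)"
proof -
  obtain \<pi> where \<pi>: "\<pi> permutes {..<k}" and P: "P = mat k k (\<lambda>(i,j). if j = \<pi> i then 1 else 0)"
    using assms by (auto simp: permutation_mat_def)
  obtain \<sigma> where \<sigma>: "\<sigma> permutes {..<l}" and Q: "Q = mat l l (\<lambda>(i,j). if j = \<sigma> i then 1 else 0)"
    using assms by (auto simp: permutation_mat_def)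
  have \<pi>_less: "\<pi> i < k" if "i < k" for i using permutes_in_image[OF \<pi>] that by auto
  have \<sigma>_less: "inv_into UNIV \<sigma> j < l" if "j < l" for j
    using permutes_in_image[OF permutes_inv[OF \<sigma>]] that by auto
  have PB: "(P * B) $$ (i,j) = B $$ (\<pi> i, j)" if "i < k" "j < l" for i j
    using that assms(3) \<pi>_less[OF that(1)]
    by (simp add: P scalar_prod_def if_distrib[of "\<lambda>x. x * _"] cong: if_cong)
  have "(P * B * Q) $$ (i,j) = B $$ (\<pi> i, inv_into UNIV \<sigma> j)" if "i < k" "j < l" for i j
  proof -
    \<comment> \<open>Row \<open>t\<close> of \<open>Q\<close> has its 1 in column
      \<open>\<sigma> t\<close>, so column \<open>j\<close> has it in the row given by the inverse
      permutation. This is why the columns are permuted by the inverse.\<close>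
    have "j = \<sigma> t \<longleftrightarrow> t = inv_into UNIV \<sigma> j" for t using \<sigma> by (metis permutes_inverses)
    hence "Q $$ (t,j) = (if t = inv_into UNIV \<sigma> j then 1 else 0)" if "t < l" for t
      using that \<open>j < l\<close> by (simp add: Q)
    hence "(\<Sum>t=0..<l. (P * B) $$ (i,t) * Q $$ (t,j)) =
             (\<Sum>t=0..<l. if t = inv_into UNIV \<sigma> j then (P * B) $$ (i,t) else 0)"
      by (intro sum.cong) auto
    moreover have "(P * B * Q) $$ (i,j) = (\<Sum>t=0..<l. (P * B) $$ (i,t) * Q $$ (t,j))"
      using that assms(3) by (auto simp: P Q scalar_prod_def intro!: sum.cong)
    ultimately have "(P * B * Q) $$ (i,j) = (P * B) $$ (i, inv_into UNIV \<sigma> j)"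
      using that \<sigma>_less by simp
    thus ?thesis using PB that \<sigma>_less by simp
  qed
  with \<pi>_less \<sigma>_less show thesis by (rule that)
qed

section \<open>Doubly stochastic products and the final scaling\<close>

text \<open>Row \<open>i\<close> of \<open>N * N\<^sup>T\<close> sums to the sum of row \<open>i\<close> of \<open>N\<close> weighted by column sums of \<open>N\<close>,
  all of which equal \<open>1 / r i\<close> on the support of that row.\<close>
lemma doubly_stochastic_mult_transpose:
  assumes N: "N \<in> carrier_mat k l" "nonneg_mat N"
    and row: "\<And>i. i < k \<Longrightarrow> (\<Sum>j<l. N $$ (i,j)) = r i"
    and col: "\<And>i j. i < k \<Longrightarrow> j < l \<Longrightarrow> N $$ (i,j) \<noteq> 0 \<Longrightarrow> (\<Sum>i<k. N $$ (i,j)) = 1 / r i"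
    and r: "\<And>i. i < k \<Longrightarrow> r i \<noteq> 0"
  shows "doubly_stochastic (N * transpose_mat N)"
proof -
  have ent: "(N * transpose_mat N) $$ (i,j) = (\<Sum>t<l. N $$ (i,t) * N $$ (j,t))"
    if "i < k" "j < k" for i j
    using that N by (auto simp: scalar_prod_def atLeast0LessThan intro!: sum.cong)
  have sum1: "(\<Sum>j<k. \<Sum>t<l. N $$ (i,t) * N $$ (j,t)) = 1" if i: "i < k" for i
  proof -
    have "(\<Sum>j<k. \<Sum>t<l. N $$ (i,t) * N $$ (j,t)) = (\<Sum>t<l. N $$ (i,t) * (\<Sum>j<k. N $$ (j,t)))"
      unfolding sum_distrib_left by (rule sum.swap)
    also have "\<dots> = (\<Sum>t<l. N $$ (i,t) * (1 / r i))"
    proof (intro sum.cong refl)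
      fix t assume "t \<in> {..<l}"
      thus "N $$ (i,t) * (\<Sum>j<k. N $$ (j,t)) = N $$ (i,t) * (1 / r i)"
        using col[OF i, of t] by (cases "N $$ (i,t) = 0") auto
    qed
    also have "\<dots> = 1"
      unfolding sum_distrib_right[symmetric] using row[OF i] r[OF i] by simp
    finally show ?thesis .
  qed
  have "(\<Sum>j<k. (N * transpose_mat N) $$ (i,j)) = 1" if "i < k" for i
    using sum1[OF that] ent that by simp
  moreover have "(\<Sum>j<k. (N * transpose_mat N) $$ (j,i)) = 1" if "i < k" for i
    using sum1[OF that] ent that by (simp add: mult.commute)
  moreover have "0 \<le> (N * transpose_mat N) $$ (i,j)" if "i < k" "j < k" for i j
    unfolding ent[OF that] using N that by (auto simp: nonneg_mat_def intro!: sum_nonneg)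
  ultimately show ?thesis
    using N by (auto simp: doubly_stochastic_def nonneg_mat_def)
qed

theorem theorem19:
  fixes M P Q :: "real mat" and Ms :: "real mat list" and k l :: nat
  assumes "M \<in> carrier_mat k l"
    and "nonneg_mat M"
    and "\<forall>i<k. row M i \<noteq> 0\<^sub>v l"
    and "\<forall>j<l. col M j \<noteq> 0\<^sub>v k"
    and "permutation_mat k P"
    and "permutation_mat l Q"
    and "diag_block_mat Ms \<in> carrier_mat k l"
    and "\<forall>B\<in>set Ms. positive_mat B"
    and "M = P * diag_block_mat Ms * Q"
  shows "\<exists>D E. positive_diagonal_mat k D \<and> positive_diagonal_mat l E \<and>
           (let N = D * M * E in
              doubly_stochastic (N * transpose_mat N) \<and>
              doubly_stochastic (transpose_mat N * N))"
proof -
  obtain f g :: "nat \<Rightarrow> nat" where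
    fg: "\<forall>i<k. \<forall>j<l. if f i = g j then 0 < diag_block_mat Ms $$ (i,j)
                      else diag_block_mat Ms $$ (i,j) = 0"
    using diag_block_mat_pattern[OF assms(8)] assms(7) by auto
  obtain \<pi> \<sigma> where \<pi>: "\<And>i. i < k \<Longrightarrow> \<pi> i < k" and \<sigma>: "\<And>j. j < l \<Longrightarrow> \<sigma> j < l"
    and M: "\<And>i j. i < k \<Longrightarrow> j < l \<Longrightarrow> M $$ (i,j) = diag_block_mat Ms $$ (\<pi> i, \<sigma> j)"
    using permutation_mat_mult_index[OF assms(5,6,7)] assms(9) by metis
  \<comment> \<open>Pulling the labels back along the permutations transfers the block pattern to
    \<open>M\<close> itself.\<close>
  define f' g' where "f' = f \<circ> \<pi>" and "g' = g \<circ> \<sigma>"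
  have pos: "0 < M $$ (i,j)" if "i < k" "j < l" "f' i = g' j" for i j
    using fg that M \<pi> \<sigma> by (auto simp: f'_def g'_def)
  have zero: "M $$ (i,j) = 0" if "i < k" "j < l" "f' i \<noteq> g' j" for i j
    using fg that M \<pi> \<sigma> by (auto simp: f'_def g'_def)
  \<comment> \<open>A row whose label no column shares would be a zero row.\<close>
  have row: "\<exists>j<l. f' i = g' j" if "i < k" for i
  proof (rule ccontr)
    assume "\<not> ?thesis"
    hence "row M i = 0\<^sub>v l" using zero that assms(1) by (intro eq_vecI) auto
    thus False using assms(3) that by simp
  qed
  have col: "\<exists>i<k. f' i = g' j" if "j < l" for j
  proof (rule ccontr)
    assume "\<not> ?thesis"
    hence "col M j = 0\<^sub>v k" using zero that assms(1) by (intro eq_vecI) auto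
    thus False using assms(4) that by simp
  qed
  obtain d e r where
    "\<forall>i<k. 0 < d i \<and> (\<Sum>j<l. d i * M $$ (i,j) * e j) = r (f' i)"
    "\<forall>j<l. 0 < e j \<and> (\<Sum>i<k. d i * M $$ (i,j) * e j) = 1 / r (g' j)"
    "\<forall>i<k. 0 < r (f' i)"
    using block_scaling_exists[of k l f' g' "\<lambda>i j. M $$ (i,j)", OF pos zero row col] by blast
  hence d: "\<And>i. i < k \<Longrightarrow> 0 < d i" and e: "\<And>j. j < l \<Longrightarrow> 0 < e j"
    and r: "\<And>i. i < k \<Longrightarrow> 0 < r (f' i)"
    and row_sum: "\<And>i. i < k \<Longrightarrow> (\<Sum>j<l. d i * M $$ (i,j) * e j) = r (f' i)"
    and col_sum: "\<And>j. j < l \<Longrightarrow> (\<Sum>i<k. d i * M $$ (i,j) * e j) = 1 / r (g' j)"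
    by auto
  define N where "N = mat_diag k d * M * mat_diag l e"
  have N_carrier: "N \<in> carrier_mat k l"
    unfolding N_def using assms(1) by (auto simp: mat_diag_def)
  have N: "N $$ (i,j) = d i * M $$ (i,j) * e j" if "i < k" "j < l" for i j
    using that assms(1) by (simp add: N_def mat_diag_mult_left mat_diag_mult_right[of _ k])
  have N_nonneg: "nonneg_mat N"
    using assms(1,2) N_carrier d e by (auto simp: nonneg_mat_def N less_imp_le)
  have support: "f' i = g' j" if "i < k" "j < l" "N $$ (i,j) \<noteq> 0" for i j
    using that N zero by force
  have "doubly_stochastic (N * transpose_mat N)"
  proof (rule doubly_stochastic_mult_transpose[where r = "\<lambda>i. r (f' i)", OF N_carrier N_nonneg])
    fix i j assume ij: "i < k" "j < l" "N $$ (i,j) \<noteq> 0"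
    show "(\<Sum>i<k. N $$ (i,j)) = 1 / r (f' i)" using col_sum N ij support[OF ij] by simp
  qed (use row_sum N r in force)+
  \<comment> \<open>Transposition exchanges row and column sums, so the same lemma applies with
    \<open>1 / r\<close> in place of \<open>r\<close>.\<close>
  moreover have "doubly_stochastic (transpose_mat N * transpose_mat (transpose_mat N))"
  proof (rule doubly_stochastic_mult_transpose[where r = "\<lambda>j. 1 / r (g' j)"])
    show "transpose_mat N \<in> carrier_mat l k" using N_carrier by simp
    show "nonneg_mat (transpose_mat N)" using N_carrier N_nonneg by (auto simp: nonneg_mat_def)
    fix j assume j: "j < l"
    show "(\<Sum>i<k. transpose_mat N $$ (j,i)) = 1 / r (g' j)" using j N_carrier N col_sum by simp
    \<comment> \<open>Positivity of \<open>r\<close> is known at row labels, so \<open>col\<close>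
      first supplies a row sharing the label of column \<open>j\<close>.\<close>
    show "1 / r (g' j) \<noteq> 0" using col[OF j] r by force
    fix i assume i: "i < k" and nz: "transpose_mat N $$ (j,i) \<noteq> 0"
    hence "f' i = g' j" using i j N_carrier support by simp
    thus "(\<Sum>j<l. transpose_mat N $$ (j,i)) = 1 / (1 / r (g' j))"
      using i j N_carrier N row_sum by simp
  qed
  ultimately show ?thesis
    using d e unfolding N_def
    by - (rule exI[where x = "mat_diag k d"], rule exI[where x = "mat_diag l e"],
      auto simp: Let_def positive_diagonal_mat_def diagonal_mat_def mat_diag_def)
qed

end
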